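(* Let $G$ be a tree and let $\bowtie$ be a balanced equivalence relation on $V(G)$. Then $\bowtie$ is a fixed-point coloration; that is, there exists a subgroup $\Gamma$ of the automorphism group $\operatorname{Aut}(G)$ such that $\Delta_{\bowtie}=\operatorname{Fix}(\Gamma)$.
   Context: Graphs are finite and simple: undirected, one type of vertex, one type of edge, no multiple edges and no loops. A tree is a connected graph without cycles. Write $c\sim d$ if $c,d$ are adjacent. An equivalence relation $\bowtie$ on $V(G)$ (also called a coloring) is balanced if, whenever $c\bowtie d$, there is a bijection $\beta$ from the set of neighbors of $c$ to the set of neighbors of $d$ with $v\bowtie\beta(v)$ for every neighbor $v$ of $c$. Every cell (vertex) $c$ has the same phase space $P_c=P_0$, a nonzero finite-dimensional real vector space, and the total phase space is $P=\prod_{c\in V(G)}P_c$. The polydiagonal subspace is $\Delta_{\bowtie}=\{x\in P: x_c=x_d \text{ whenever } c\bowtie d\}$. $\operatorname{Aut}(G)$ acts on $P$ by permuting coordinates, and $\operatorname{Fix}(\Gamma)=\{x\in P:\gamma x=x\ \text{for all } \gamma\in\Gamma\}$. *)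

theory Defs
  imports
    Complex_Main
    "HOL-Algebra.Bij"
    "HOL-Algebra.Group_Action"
    "Graph_Theory.Graph_Theory"
begin

text \<open>
  A finite simple graph is a \<^locale>\<open>pair_graph\<close>: every undirected edge is represented by its two
  orientations. The library's own \<^const>\<open>tree\<close> is unsuitable here, since for a symmetric digraph
  it counts the walk \<open>u, v, u\<close> along a single edge as a cycle. Because there are neither loops nor
  parallel arcs, the cycles of the undirected graph are exactly the directed ones of length at
  least 3.
\<close>

definition undirected_tree :: "'a pair_pre_digraph \<Rightarrow> bool" where
  "undirected_tree G \<longleftrightarrow>
     pair_graph G \<and> Digraph_Component.connected (with_proj G) \<and>
     \<not> (\<exists>p. pre_digraph.cycle (with_proj G) p \<and> 3 \<le> length p)"

definition neighbors :: "'a pair_pre_digraph \<Rightarrow> 'a \<Rightarrow> 'a set" where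
  "neighbors G c = {v. c \<rightarrow>\<^bsub>with_proj G\<^esub> v}"

definition balanced :: "'a pair_pre_digraph \<Rightarrow> 'a rel \<Rightarrow> bool" where
  "balanced G R \<longleftrightarrow>
     equiv (pverts G) R \<and>
     (\<forall>c d. (c, d) \<in> R \<longrightarrow>
        (\<exists>\<beta>. bij_betw \<beta> (neighbors G c) (neighbors G d) \<and>
             (\<forall>v\<in>neighbors G c. (v, \<beta> v) \<in> R)))"

definition graph_Aut :: "'a pair_pre_digraph \<Rightarrow> ('a \<Rightarrow> 'a) monoid" where
  "graph_Aut G = (BijGroup (pverts G))
     \<lparr>carrier := {\<gamma> \<in> Bij (pverts G).
        \<forall>u\<in>pverts G. \<forall>v\<in>pverts G.
          (u \<rightarrow>\<^bsub>with_proj G\<^esub> v) \<longleftrightarrow> (\<gamma> u \<rightarrow>\<^bsub>with_proj G\<^esub> \<gamma> v)}\<rparr>"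

lemma group_graph_Aut:
  fixes G :: "'a pair_pre_digraph"
  shows "group (graph_Aut G)"
proof -
  let ?V = "pverts G"
  let ?A = "carrier (graph_Aut G)"
  let ?adj = "\<lambda>u v. u \<rightarrow>\<^bsub>with_proj G\<^esub> v"
  interpret B: group "BijGroup ?V" by (rule group_BijGroup)
  have Bij: "\<gamma> \<in> Bij ?V" if "\<gamma> \<in> ?A" for \<gamma>
    using that by (simp add: graph_Aut_def)
  have adj: "?adj u v \<longleftrightarrow> ?adj (\<gamma> u) (\<gamma> v)"
    if "\<gamma> \<in> ?A" "u \<in> ?V" "v \<in> ?V" for \<gamma> u v
    using that unfolding graph_Aut_def by simp
  have AI: "\<gamma> \<in> ?A" if "\<gamma> \<in> Bij ?V"
    "\<And>u v. u \<in> ?V \<Longrightarrow> v \<in> ?V \<Longrightarrow> ?adj u v \<longleftrightarrow> ?adj (\<gamma> u) (\<gamma> v)" for \<gamma>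
    using that unfolding graph_Aut_def by simp
  have "subgroup ?A (BijGroup ?V)"
  proof (rule B.subgroupI)
    show "?A \<subseteq> carrier (BijGroup ?V)"
      using Bij by (auto simp: BijGroup_def)
    have "(\<lambda>x\<in>?V. x) \<in> ?A"
      by (rule AI) (auto intro: id_Bij)
    then show "?A \<noteq> {}" by blast
  next
    fix \<gamma> assume g: "\<gamma> \<in> ?A"
    have bb: "bij_betw \<gamma> ?V ?V" using Bij[OF g] by (simp add: Bij_def)
    have "(\<lambda>x\<in>?V. inv_into ?V \<gamma> x) \<in> ?A"
    proof (rule AI)
      show "(\<lambda>x\<in>?V. inv_into ?V \<gamma> x) \<in> Bij ?V"
        by (rule restrict_inv_into_Bij[OF Bij[OF g]])
      fix u v assume "u \<in> ?V" "v \<in> ?V"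
      then show "?adj u v \<longleftrightarrow>
          ?adj ((\<lambda>x\<in>?V. inv_into ?V \<gamma> x) u) ((\<lambda>x\<in>?V. inv_into ?V \<gamma> x) v)"
        using adj[OF g, of "inv_into ?V \<gamma> u" "inv_into ?V \<gamma> v"] bb
        by (metis (no_types, lifting) bij_betw_imp_surj_on f_inv_into_f inv_into_into restrict_apply')
    qed
    then show "inv\<^bsub>BijGroup ?V\<^esub> \<gamma> \<in> ?A"
      using inv_BijGroup[OF Bij[OF g]] by simp
  next
    fix \<gamma> \<delta> assume g: "\<gamma> \<in> ?A" and d: "\<delta> \<in> ?A"
    have m: "\<delta> u \<in> ?V" if "u \<in> ?V" for u
      using Bij_imp_funcset[OF Bij[OF d]] that by blast
    have "compose ?V \<gamma> \<delta> \<in> ?A"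
    proof (rule AI)
      show "compose ?V \<gamma> \<delta> \<in> Bij ?V" by (rule compose_Bij[OF Bij[OF g] Bij[OF d]])
      fix u v assume uv: "u \<in> ?V" "v \<in> ?V"
      show "?adj u v \<longleftrightarrow> ?adj (compose ?V \<gamma> \<delta> u) (compose ?V \<gamma> \<delta> v)"
        using adj[OF d uv] adj[OF g m[OF uv(1)] m[OF uv(2)]] uv by (simp add: compose_eq)
    qed
    then show "\<gamma> \<otimes>\<^bsub>BijGroup ?V\<^esub> \<delta> \<in> ?A"
      using Bij[OF g] Bij[OF d] by (simp add: BijGroup_def)
  qed
  then show ?thesis
    using B.subgroup_imp_group by (simp add: graph_Aut_def)
qed

text \<open>The type \<open>'v\<close> is the phase space common to all vertices.\<close>

definition phase_space :: "'a pair_pre_digraph \<Rightarrow> ('a \<Rightarrow> 'v::real_vector) set" where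
  "phase_space G = pverts G \<rightarrow>\<^sub>E UNIV"

definition polydiagonal :: "'a pair_pre_digraph \<Rightarrow> 'a rel \<Rightarrow> ('a \<Rightarrow> 'v::real_vector) set" where
  "polydiagonal G R = {x \<in> phase_space G. \<forall>c d. (c, d) \<in> R \<longrightarrow> x c = x d}"

text \<open>The inverse makes the permutation of coordinates a left action.\<close>

definition coord_action ::
    "'a pair_pre_digraph \<Rightarrow> ('a \<Rightarrow> 'a) \<Rightarrow> ('a \<Rightarrow> 'v::real_vector) \<Rightarrow> 'a \<Rightarrow> 'v" where
  "coord_action G \<gamma> =
     (\<lambda>x\<in>phase_space G. \<lambda>c\<in>pverts G. x ((inv\<^bsub>graph_Aut G\<^esub> \<gamma>) c))"

lemma group_action_coord_action:
  fixes G :: "'a pair_pre_digraph"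
  shows "group_action (graph_Aut G) (phase_space G :: ('a \<Rightarrow> 'v::real_vector) set)
           (coord_action G)"
proof -
  let ?V = "pverts G"
  let ?P = "phase_space G :: ('a \<Rightarrow> 'v) set"
  interpret A: group "graph_Aut G" by (rule group_graph_Aut)
  have mult: "\<gamma> \<otimes>\<^bsub>graph_Aut G\<^esub> \<delta> = compose ?V \<gamma> \<delta>"
    if "\<gamma> \<in> carrier (graph_Aut G)" "\<delta> \<in> carrier (graph_Aut G)" for \<gamma> \<delta>
    using that by (simp add: graph_Aut_def BijGroup_def)
  have one: "\<one>\<^bsub>graph_Aut G\<^esub> = (\<lambda>x\<in>?V. x)"
    by (simp add: graph_Aut_def BijGroup_def)
  have maps: "\<gamma> c \<in> ?V" if "\<gamma> \<in> carrier (graph_Aut G)" "c \<in> ?V" for \<gamma> c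
    using that Bij_imp_funcset[of \<gamma> ?V] by (auto simp: graph_Aut_def)
  have P: "coord_action G \<gamma> x \<in> ?P" if "x \<in> ?P" for \<gamma> x
    using that by (simp add: coord_action_def phase_space_def)
  have comp: "coord_action G (\<gamma> \<otimes>\<^bsub>graph_Aut G\<^esub> \<delta>) x = coord_action G \<gamma> (coord_action G \<delta> x)"
    if g: "\<gamma> \<in> carrier (graph_Aut G)" and d: "\<delta> \<in> carrier (graph_Aut G)" and x: "x \<in> ?P" for \<gamma> \<delta> x
  proof
    fix c
    show "coord_action G (\<gamma> \<otimes>\<^bsub>graph_Aut G\<^esub> \<delta>) x c = coord_action G \<gamma> (coord_action G \<delta> x) c"
      using x P[OF x, of \<delta>] maps[OF A.inv_closed[OF g], of c]
      by (simp add: coord_action_def A.inv_mult_group[OF g d] compose_eq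
          mult[OF A.inv_closed[OF d] A.inv_closed[OF g]])
  qed
  have id: "coord_action G \<one>\<^bsub>graph_Aut G\<^esub> x = x" if x: "x \<in> ?P" for x
  proof
    fix c
    show "coord_action G \<one>\<^bsub>graph_Aut G\<^esub> x c = x c"
      using x A.inv_one by (auto simp: coord_action_def one phase_space_def PiE_def extensional_def)
  qed
  have Bij: "coord_action G \<gamma> \<in> Bij ?P" if g: "\<gamma> \<in> carrier (graph_Aut G)" for \<gamma>
  proof -
    have "bij_betw (coord_action G \<gamma>) ?P ?P"
      by (rule bij_betw_byWitness[where f' = "coord_action G (inv\<^bsub>graph_Aut G\<^esub> \<gamma>)"])
        (use g P id comp[symmetric] in auto)
    then show ?thesis by (simp add: Bij_def coord_action_def)
  qed
  show ?thesis
    unfolding group_action_def group_hom_def group_hom_axioms_def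
  proof (intro conjI group_graph_Aut group_BijGroup homI)
    fix \<gamma> \<delta> assume g: "\<gamma> \<in> carrier (graph_Aut G)" and d: "\<delta> \<in> carrier (graph_Aut G)"
    have "coord_action G (\<gamma> \<otimes>\<^bsub>graph_Aut G\<^esub> \<delta>) x =
        compose ?P (coord_action G \<gamma>) (coord_action G \<delta>) x" for x :: "'a \<Rightarrow> 'v"
      using comp[OF g d, of x]
      by (cases "x \<in> ?P") (auto simp: compose_def coord_action_def)
    then show "coord_action G (\<gamma> \<otimes>\<^bsub>graph_Aut G\<^esub> \<delta>) =
        coord_action G \<gamma> \<otimes>\<^bsub>BijGroup ?P\<^esub> coord_action G \<delta>"
      using Bij[OF g] Bij[OF d] by (auto simp: BijGroup_def)
  qed (use Bij in \<open>simp add: BijGroup_def\<close>)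
qed

definition Fix :: "'a pair_pre_digraph \<Rightarrow> ('a \<Rightarrow> 'a) set \<Rightarrow> ('a \<Rightarrow> 'v::real_vector) set" where
  "Fix G \<Gamma> = {x \<in> phase_space G. \<forall>\<gamma>\<in>\<Gamma>. coord_action G \<gamma> x = x}"

end

theory Submission
  imports Defs
begin

text \<open>
  A finite tree is its own universal cover. So given \<open>c\<close> and \<open>d\<close> of the same colour, the assignment
  \<open>c \<mapsto> d\<close> can be extended one vertex at a time to a colour-preserving, locally injective map of the
  tree: each new vertex is attached to the connected part already treated by a single edge, and
  balancedness leaves room for its image. The map obtained on the whole tree is locally
  bijective, hence onto by connectedness, hence an automorphism by finiteness. The colour-preserving
  automorphisms therefore act transitively on every colour class.
\<close>

section \<open>Paths and connected vertex sets\<close>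

lemma mem_neighbors_iff [simp]: "v \<in> neighbors G c \<longleftrightarrow> (c, v) \<in> parcs G"
  by (simp add: neighbors_def)

context pair_graph
begin

lemma finite_neighbors: "finite (neighbors G c)"
  by (rule finite_subset[OF _ pair_finite_verts]) (auto dest: in_arcsD2)

lemma arc_sym: "(u, v) \<in> parcs G \<Longrightarrow> (v, u) \<in> parcs G"
  using pair_sym_arcs by (auto simp: symmetric_def dest: symD)

text \<open>Connectedness as an induction principle. It is applied to the domain of a maximal
  partial map and to the image of a map on all vertices.\<close>

lemma connected_closed_eq_verts:
  assumes con: "Digraph_Component.connected (with_proj G)"
    and c: "c \<in> S" and S: "S \<subseteq> pverts G"
    and closed: "\<And>v u. v \<in> S \<Longrightarrow> (v, u) \<in> parcs G \<Longrightarrow> u \<in> S"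
  shows "S = pverts G"
proof
  show "pverts G \<subseteq> S"
  proof
    fix v assume v: "v \<in> pverts G"
    \<comment> \<open>\<open>connected\<close> speaks of the symmetric closure; since
      \<open>G\<close> is symmetric, reachability there is reachability in \<open>G\<close>.\<close>
    have "c \<rightarrow>\<^sup>*\<^bsub>mk_symmetric (with_proj G)\<^esub> v"
      using con c S v by (auto simp: connected_def strongly_connected_def)
    then have "c \<rightarrow>\<^sup>*\<^bsub>with_proj G\<^esub> v"
      using reachable_mk_symmetric_eq by auto
    then have "(c, v) \<in> (parcs G)\<^sup>*"
      using reachable_rtranclI by fastforce
    then show "v \<in> S"
      by (induction rule: rtrancl_induct) (use c closed in auto)
  qed
qed (rule S)

text \<open>Connectedness of the subgraph induced on \<open>S\<close>, expressed through paths of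
  the ambient graph. The vertices of an \<open>apath\<close> are distinct, so such a path can later
  be closed up to a cycle.\<close>

definition apath_connected :: "'a set \<Rightarrow> bool" where
  "apath_connected S \<longleftrightarrow> (\<forall>v\<in>S. \<forall>w\<in>S. \<exists>p. apath v p w \<and> set (pawalk_verts v p) \<subseteq> S)"

text \<open>A path inside \<open>S\<close> with an end at \<open>v\<close> avoids \<open>u\<close>,
  so it keeps distinct vertices when the edge between \<open>v\<close> and \<open>u\<close> is added
  there.\<close>

lemma apath_connected_insert:
  assumes S: "apath_connected S" and v: "v \<in> S" and u: "u \<notin> S" and vu: "(v, u) \<in> parcs G"
  shows "apath_connected (insert u S)"
  unfolding apath_connected_def
proof (intro ballI)
  have uV: "u \<in> pverts G" using in_arcsD2[OF vu] .
  fix x y assume x: "x \<in> insert u S" and y: "y \<in> insert u S"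
  consider "x \<in> S" "y \<in> S" | "x = u" "y = u" | "x = u" "y \<in> S" | "x \<in> S" "y = u"
    using x y by auto
  then show "\<exists>p. apath x p y \<and> set (pawalk_verts x p) \<subseteq> insert u S"
  proof cases
    case 1
    then show ?thesis using S unfolding apath_connected_def by blast
  next
    case 2
    then show ?thesis using uV by (intro exI[of _ "[]"]) (simp add: apath_Nil_iff)
  next
    case 3
    then obtain p where "apath v p y" "set (pawalk_verts v p) \<subseteq> S"
      using S v unfolding apath_connected_def by blast
    then show ?thesis
      using 3 u arc_sym[OF vu] by (intro exI[of _ "(u, v) # p"]) (auto simp: apath_Cons_iff)
  next
    case 4
    then obtain p where p: "apath x p v" "set (pawalk_verts x p) \<subseteq> S"
      using S v unfolding apath_connected_def by blast
    then have "awlast x p = v" by (auto simp: apath_def)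
    then show ?thesis
      using 4 u p vu uV in_arcsD1[OF vu]
      by (intro exI[of _ "p @ [(v, u)]"])
        (auto simp: apath_append_iff apath_simps awalk_verts_conv split: if_splits)
  qed
qed

text \<open>Two different attaching vertices, joined by a path inside \<open>S\<close>, would close
  up through \<open>u\<close> to a cycle.\<close>

lemma acyclic_unique_attachment:
  assumes acyc: "\<And>p. cycle p \<Longrightarrow> length p < 3"
    and S: "apath_connected S" and u: "u \<notin> S" and v: "v \<in> S" "(v, u) \<in> parcs G"
    and w: "w \<in> S" "(w, u) \<in> parcs G"
  shows "v = w"
proof (rule ccontr)
  assume ne: "v \<noteq> w"
  obtain p where p: "apath v p w" "set (pawalk_verts v p) \<subseteq> S"
    using S v w unfolding apath_connected_def by blast
  have p0: "p \<noteq> []" using p ne by (auto simp: apath_Nil_iff)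
  let ?q = "(u, v) # p @ [(w, u)]"
  have aw: "awalk v p w" and dist: "distinct (pawalk_verts v p)"
    using p by (auto simp: apath_def)
  have "awalk w [(w, u)] u"
    using w in_arcsD1 in_arcsD2 by (auto simp: awalk_simps)
  then have aw': "awalk v (p @ [(w, u)]) u" using aw by (rule awalk_appendI[rotated])
  then have "awalk u ?q u"
    using arc_sym[OF v(2)] in_arcsD2[OF v(2)] by (auto simp: awalk_Cons_iff)
  moreover have "pawalk_verts v (p @ [(w, u)]) = pawalk_verts v p @ [u]"
    using awalk_verts_append[OF aw'] aw by auto
  then have "distinct (tl (pawalk_verts u ?q))"
    using dist p u by auto
  ultimately have "cycle ?q" unfolding cycle_def by blast
  then have "length ?q < 3" by (rule acyc)
  \<comment> \<open>A nonempty \<open>p\<close> and the two arcs at \<open>u\<close> give length at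
    least 3, so \<open>?q\<close> is not a mere walk back and forth along one edge.\<close>
  then show False using p0 by (cases p) auto
qed

end

section \<open>Balanced colourings and extension of colour-preserving maps\<close>

lemma balanced_card_colour:
  assumes bal: "balanced G R" and ab: "(a, b) \<in> R"
  shows "card {x \<in> neighbors G a. (x, k) \<in> R} = card {x \<in> neighbors G b. (x, k) \<in> R}"
proof -
  obtain \<beta> where \<beta>: "bij_betw \<beta> (neighbors G a) (neighbors G b)"
    and col: "\<forall>v\<in>neighbors G a. (v, \<beta> v) \<in> R"
    using bal ab unfolding balanced_def by blast
  have R: "sym R" "trans R"
    using bal unfolding balanced_def equiv_def by auto
  \<comment> \<open>Since \<beta> preserves and reflects the colour of \<open>k\<close>, it
    restricts to a bijection between the neighbours of that colour.\<close>
  have "(\<beta> x, k) \<in> R \<longleftrightarrow> (x, k) \<in> R" if "x \<in> neighbors G a" for x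
    using col[rule_format, OF that] by (blast intro: transD[OF R(2)] symD[OF R(1)])
  then have "\<beta> ` {x \<in> neighbors G a. (x, k) \<in> R} = {x \<in> neighbors G b. (x, k) \<in> R}"
    unfolding bij_betw_imp_surj_on[OF \<beta>, symmetric] by (auto simp del: mem_neighbors_iff)
  moreover have "inj_on \<beta> {x \<in> neighbors G a. (x, k) \<in> R}"
    using \<beta> by (auto simp: bij_betw_def inj_on_def)
  ultimately show ?thesis by (intro bij_betw_same_card bij_betw_imageI)
qed

text \<open>A partial form of a covering map: injectivity is asked only among neighbours in
  \<open>S\<close>, so that \<open>S\<close> can grow. The values of \<open>f\<close> outside
  \<open>S\<close> do not matter.\<close>

definition colour_immersion ::
    "'a pair_pre_digraph \<Rightarrow> 'a rel \<Rightarrow> 'a set \<Rightarrow> ('a \<Rightarrow> 'a) \<Rightarrow> bool" where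
  "colour_immersion G R S f \<longleftrightarrow>
     (\<forall>v\<in>S. (v, f v) \<in> R \<and> inj_on f (neighbors G v \<inter> S) \<and>
        f ` (neighbors G v \<inter> S) \<subseteq> neighbors G (f v))"

context pair_graph
begin

text \<open>The vertex \<open>f v\<close> has as many neighbours of the colour of \<open>u\<close>
  as \<open>v\<close> has, and \<open>u\<close> is not yet mapped, so one of them is free to become
  \<open>w\<close>. As \<open>v\<close> is the only neighbour of \<open>u\<close> in
  \<open>S\<close>, no other vertex constrains the choice.\<close>

lemma colour_immersion_insert:
  assumes acyc: "\<And>p. cycle p \<Longrightarrow> length p < 3" and bal: "balanced G R"
    and S: "apath_connected S" and f: "colour_immersion G R S f"
    and v: "v \<in> S" and u: "u \<notin> S" and vu: "(v, u) \<in> parcs G"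
  obtains w where "colour_immersion G R (insert u S) (f(u := w))"
proof -
  have R: "sym R" "trans R" "(u, u) \<in> R"
    using bal in_arcsD2[OF vu] unfolding balanced_def equiv_def refl_on_def by auto
  have f1: "(x, f x) \<in> R" and f2: "inj_on f (neighbors G x \<inter> S)"
    and f3: "f ` (neighbors G x \<inter> S) \<subseteq> neighbors G (f x)" if "x \<in> S" for x
    using f that unfolding colour_immersion_def by auto
  let ?A = "{x \<in> neighbors G v. (x, u) \<in> R}" and ?B = "{x \<in> neighbors G (f v). (x, u) \<in> R}"
  have fin: "finite ?A" using finite_neighbors by (rule finite_subset[rotated]) auto
  have "card (f ` (?A \<inter> S)) \<le> card (?A \<inter> S)" by (rule card_image_le) (use fin in auto)
  also have "\<dots> < card ?A" by (rule psubset_card_mono[OF fin]) (use u vu R in auto)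
  also have "\<dots> = card ?B" by (rule balanced_card_colour[OF bal f1[OF v]])
  finally have "\<not> ?B \<subseteq> f ` (?A \<inter> S)"
    using fin by (meson card_mono finite_Int finite_imageI leD)
  then obtain w where w: "w \<in> ?B" "w \<notin> f ` (?A \<inter> S)" by blast
  \<comment> \<open>The count excludes only images of neighbours coloured like \<open>u\<close>. A
    neighbour in \<open>S\<close> of another colour cannot hit \<open>w\<close> either, because
    \<open>f\<close> preserves colours.\<close>
  have wnew: "w \<notin> f ` (neighbors G v \<inter> S)"
  proof
    assume "w \<in> f ` (neighbors G v \<inter> S)"
    then obtain x where x: "w = f x" "x \<in> neighbors G v" "x \<in> S" by blast
    then have "(x, w) \<in> R" using f1[of x] by simp
    then have "(x, u) \<in> R" using w(1) by (blast intro: transD[OF R(2)])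
    then show False using x w by auto
  qed
  have only_v: "x = v" if "x \<in> S" "(x, u) \<in> parcs G" for x
    using acyclic_unique_attachment[OF acyc S u that v vu] .
  have "colour_immersion G R (insert u S) (f(u := w))"
    unfolding colour_immersion_def
  proof (intro ballI)
    fix x assume x: "x \<in> insert u S"
    let ?f = "f(u := w)"
    \<comment> \<open>At \<open>u\<close> the only neighbour is \<open>v\<close>; at
      \<open>v\<close> the value \<open>w\<close> is new; elsewhere the relevant neighbourhood and
      values are unchanged.\<close>
    consider "x = u" | "x = v" | "x \<in> S" "x \<noteq> v" using x by blast
    then show "(x, ?f x) \<in> R \<and> inj_on ?f (neighbors G x \<inter> insert u S) \<and>
        ?f ` (neighbors G x \<inter> insert u S) \<subseteq> neighbors G (?f x)"
    proof cases
      case 1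
      have "neighbors G u \<inter> insert u S = {v}"
        using v arc_sym[OF vu] by (auto dest: no_loops' only_v[OF _ arc_sym])
      moreover have "(u, w) \<in> R" using w R by (auto dest: symD)
      moreover have "(w, f v) \<in> parcs G" using w arc_sym by auto
      ultimately show ?thesis using 1 u v by auto
    next
      case 2
      have eq: "neighbors G v \<inter> insert u S = insert u (neighbors G v \<inter> S)"
        using vu by auto
      have img: "?f ` (neighbors G v \<inter> S) = f ` (neighbors G v \<inter> S)"
        using u by (intro image_cong) auto
      have "inj_on ?f (neighbors G v \<inter> S)"
        using f2[OF v] u by (auto simp: inj_on_def)
      then have "inj_on ?f (insert u (neighbors G v \<inter> S))"
        using wnew img u by auto
      moreover have "?f ` insert u (neighbors G v \<inter> S) \<subseteq> neighbors G (f v)"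
        using img f3[OF v] w(1) by auto
      moreover have "?f v = f v" using u v by auto
      ultimately show ?thesis using 2 f1[OF v] eq by metis
    next
      case 3
      have eq: "neighbors G x \<inter> insert u S = neighbors G x \<inter> S"
        using 3 by (auto dest: only_v)
      have img: "?f ` (neighbors G x \<inter> S) = f ` (neighbors G x \<inter> S)"
        using u by (intro image_cong) auto
      have "inj_on ?f (neighbors G x \<inter> S)"
        using f2[OF 3(1)] u by (auto simp: inj_on_def)
      then show ?thesis
        using 3 u f1 f3 img unfolding eq by auto
    qed
  qed
  then show thesis by (rule that)
qed

text \<open>A connected domain of maximal size under inclusion has no edge leaving it, since such an
  edge would allow a one-vertex extension; hence it is the whole tree.\<close>

lemma colour_immersion_exists:
  assumes con: "Digraph_Component.connected (with_proj G)"
    and acyc: "\<And>p. cycle p \<Longrightarrow> length p < 3" and bal: "balanced G R" and cd: "(c, d) \<in> R"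
  obtains f where "colour_immersion G R (pverts G) f" "f c = d"
proof -
  let ?P = "\<lambda>S f. c \<in> S \<and> apath_connected S \<and> f c = d \<and> colour_immersion G R S f"
  \<comment> \<open>Only the domains are ordered, with the map existentially quantified;
    \<open>F\<close> is then finite and has maximal elements.\<close>
  define F where "F = {S \<in> Pow (pverts G). \<exists>f. ?P S f}"
  have F: "S \<in> F \<longleftrightarrow> S \<subseteq> pverts G \<and> (\<exists>f. ?P S f)" for S
    unfolding F_def by simp
  have "finite F"
    unfolding F_def by (rule finite_subset[of _ "Pow (pverts G)"]) (auto simp: pair_finite_verts)
  have cV: "c \<in> pverts G"
    using bal cd equiv_type[of "pverts G" R] unfolding balanced_def by blast
  \<comment> \<open>Without loops, the neighbourhood conditions on the one-point domain are
    vacuous.\<close>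
  have "neighbors G c \<inter> {c} = {}" using no_loops' by auto
  then have "colour_immersion G R {c} (\<lambda>_. d)"
    using cd unfolding colour_immersion_def by simp
  moreover have "apath c [] c" "set (pawalk_verts c []) \<subseteq> {c}"
    using cV by (simp_all add: apath_Nil_iff)
  then have "apath_connected {c}"
    unfolding apath_connected_def by blast
  ultimately have "?P {c} (\<lambda>_. d)" by simp
  then have "\<exists>f. ?P {c} f" by (rule exI[of _ "\<lambda>_. d"])
  then have "{c} \<in> F" unfolding F using cV by simp
  then obtain S where S: "S \<in> F" and max: "\<And>T. T \<in> F \<Longrightarrow> S \<subseteq> T \<Longrightarrow> S = T"
    using finite_has_maximal2[OF \<open>finite F\<close>] by metis
  obtain f where f: "?P S f" using S unfolding F by blast
  have SV: "S \<subseteq> pverts G" using S unfolding F by (rule conjunct1)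
  have "S = pverts G"
  proof (rule connected_closed_eq_verts[OF con, of c])
    fix v u assume v: "v \<in> S" and vu: "(v, u) \<in> parcs G"
    show "u \<in> S"
    proof (rule ccontr)
      assume u: "u \<notin> S"
      obtain w where "colour_immersion G R (insert u S) (f(u := w))"
        using colour_immersion_insert[OF acyc bal _ _ v u vu] f by blast
      then have "?P (insert u S) (f(u := w))"
        using f u apath_connected_insert[OF _ v u vu] by auto
      then have "\<exists>f. ?P (insert u S) f" by (rule exI[of _ "f(u := w)"])
      then have "insert u S \<in> F" unfolding F using SV in_arcsD2[OF vu] by simp
      then show False using max[of "insert u S"] u by blast
    qed
  qed (use f SV in simp_all)
  then show thesis using that[of f] f by simp
qed

text \<open>Balancedness upgrades local injectivity to local bijectivity. The image is then closed
  under adjacency, so \<open>f\<close> is onto, and finiteness makes it injective. The restriction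
  makes \<open>f\<close> extensional, as \<open>Bij\<close> demands.\<close>

lemma colour_immersion_automorphism:
  assumes con: "Digraph_Component.connected (with_proj G)"
    and bal: "balanced G R" and f: "colour_immersion G R (pverts G) f"
  shows "restrict f (pverts G) \<in> carrier (graph_Aut G)"
proof (cases "pverts G = {}")
  case True
  then show ?thesis by (auto simp: graph_Aut_def Bij_def bij_betw_def extensional_def)
next
  case False
  have fV: "f v \<in> pverts G" if "v \<in> pverts G" for v
    using f bal that equiv_type unfolding colour_immersion_def balanced_def by fastforce
  have nb: "f ` neighbors G v = neighbors G (f v)" if v: "v \<in> pverts G" for v
  proof (rule card_subset_eq[OF finite_neighbors])
    have "neighbors G v \<inter> pverts G = neighbors G v" by (auto dest: in_arcsD2)
    then have *: "(v, f v) \<in> R" "inj_on f (neighbors G v)"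
      "f ` neighbors G v \<subseteq> neighbors G (f v)"
      using f v unfolding colour_immersion_def by auto
    then show "f ` neighbors G v \<subseteq> neighbors G (f v)" by simp
    obtain \<beta> where "bij_betw \<beta> (neighbors G v) (neighbors G (f v))"
      using bal * unfolding balanced_def by blast
    then show "card (f ` neighbors G v) = card (neighbors G (f v))"
      using * by (simp add: card_image bij_betw_same_card)
  qed
  have onto: "f ` pverts G = pverts G"
  proof -
    obtain c where "c \<in> pverts G" using False by blast
    show ?thesis
    proof (rule connected_closed_eq_verts[OF con, of "f c"])
      fix v u assume "v \<in> f ` pverts G" "(v, u) \<in> parcs G"
      then obtain x where "x \<in> pverts G" "u \<in> neighbors G (f x)" by auto
      then show "u \<in> f ` pverts G" using nb[of x] in_arcsD2 by force
    qed (use \<open>c \<in> pverts G\<close> fV in auto)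
  qed
  then have inj: "inj_on f (pverts G)"
    by (simp add: eq_card_imp_inj_on pair_finite_verts)
  have "(u, v) \<in> parcs G \<longleftrightarrow> (f u, f v) \<in> parcs G" if u: "u \<in> pverts G" and v: "v \<in> pverts G" for u v
  proof -
    \<comment> \<open>Local surjectivity and global injectivity together make \<open>f\<close>
      reflect adjacency as well as preserve it.\<close>
    have "(f u, f v) \<in> parcs G \<longleftrightarrow> f v \<in> f ` neighbors G u"
      using nb[OF u] by simp
    also have "\<dots> \<longleftrightarrow> v \<in> neighbors G u"
      by (rule inj_on_image_mem_iff[OF inj v]) (auto dest: in_arcsD2)
    finally show ?thesis by simp
  qed
  then show ?thesis
    using onto inj by (simp add: graph_Aut_def Bij_def bij_betw_def inj_on_def)
qed

end

section \<open>The group of colour-preserving automorphisms\<close>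

definition colour_Aut :: "'a pair_pre_digraph \<Rightarrow> 'a rel \<Rightarrow> ('a \<Rightarrow> 'a) set" where
  "colour_Aut G R = {\<gamma> \<in> carrier (graph_Aut G). \<forall>v\<in>pverts G. (v, \<gamma> v) \<in> R}"

lemma graph_Aut_maps:
  "\<gamma> \<in> carrier (graph_Aut G) \<Longrightarrow> v \<in> pverts G \<Longrightarrow> \<gamma> v \<in> pverts G"
  using Bij_imp_funcset[of \<gamma> "pverts G"] by (auto simp: graph_Aut_def)

lemma graph_Aut_mult:
  assumes "\<gamma> \<in> carrier (graph_Aut G)" "\<delta> \<in> carrier (graph_Aut G)" "v \<in> pverts G"
  shows "(\<gamma> \<otimes>\<^bsub>graph_Aut G\<^esub> \<delta>) v = \<gamma> (\<delta> v)"
  using assms by (simp add: graph_Aut_def BijGroup_def compose_eq)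

lemma graph_Aut_inv_cancel:
  assumes g: "\<gamma> \<in> carrier (graph_Aut G)" and v: "v \<in> pverts G"
  shows "\<gamma> ((inv\<^bsub>graph_Aut G\<^esub> \<gamma>) v) = v" "(inv\<^bsub>graph_Aut G\<^esub> \<gamma>) (\<gamma> v) = v"
proof -
  interpret A: group "graph_Aut G" by (rule group_graph_Aut)
  have one: "\<one>\<^bsub>graph_Aut G\<^esub> v = v"
    using v by (simp add: graph_Aut_def BijGroup_def)
  show "\<gamma> ((inv\<^bsub>graph_Aut G\<^esub> \<gamma>) v) = v"
    using graph_Aut_mult[OF g A.inv_closed[OF g] v] A.r_inv[OF g] one by simp
  show "(inv\<^bsub>graph_Aut G\<^esub> \<gamma>) (\<gamma> v) = v"
    using graph_Aut_mult[OF A.inv_closed[OF g] g v] A.l_inv[OF g] one by simp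
qed

lemma subgroup_colour_Aut:
  assumes R: "equiv (pverts G) R"
  shows "subgroup (colour_Aut G R) (graph_Aut G)"
proof -
  interpret A: group "graph_Aut G" by (rule group_graph_Aut)
  have sym: "sym R" and trans: "trans R" and refl: "\<And>v. v \<in> pverts G \<Longrightarrow> (v, v) \<in> R"
    using R by (auto simp: equiv_def refl_on_def)
  show ?thesis
  proof (rule A.subgroupI)
    show "colour_Aut G R \<subseteq> carrier (graph_Aut G)" by (auto simp: colour_Aut_def)
    have "\<one>\<^bsub>graph_Aut G\<^esub> v = v" if "v \<in> pverts G" for v
      using that by (simp add: graph_Aut_def BijGroup_def)
    then have "\<one>\<^bsub>graph_Aut G\<^esub> \<in> colour_Aut G R" using refl by (auto simp: colour_Aut_def)
    then show "colour_Aut G R \<noteq> {}" by blast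
  next
    fix \<gamma> assume g: "\<gamma> \<in> colour_Aut G R"
    then have gA: "\<gamma> \<in> carrier (graph_Aut G)" by (simp add: colour_Aut_def)
    have "(v, (inv\<^bsub>graph_Aut G\<^esub> \<gamma>) v) \<in> R" if v: "v \<in> pverts G" for v
    proof -
      \<comment> \<open>The colour condition for \<gamma> is used at the preimage of
        \<open>v\<close>, and symmetry of \<open>R\<close> turns it around.\<close>
      have "((inv\<^bsub>graph_Aut G\<^esub> \<gamma>) v, \<gamma> ((inv\<^bsub>graph_Aut G\<^esub> \<gamma>) v)) \<in> R"
        using g graph_Aut_maps[OF A.inv_closed[OF gA] v] by (simp add: colour_Aut_def)
      then show ?thesis using graph_Aut_inv_cancel(1)[OF gA v] sym by (auto dest: symD)
    qed
    then show "inv\<^bsub>graph_Aut G\<^esub> \<gamma> \<in> colour_Aut G R"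
      using gA by (simp add: colour_Aut_def)
  next
    fix \<gamma> \<delta> assume g: "\<gamma> \<in> colour_Aut G R" and d: "\<delta> \<in> colour_Aut G R"
    then have A: "\<gamma> \<in> carrier (graph_Aut G)" "\<delta> \<in> carrier (graph_Aut G)"
      by (simp_all add: colour_Aut_def)
    have "(v, \<gamma> (\<delta> v)) \<in> R" if v: "v \<in> pverts G" for v
      using g d v graph_Aut_maps[OF A(2) v] trans unfolding colour_Aut_def by (blast dest: transD)
    then show "\<gamma> \<otimes>\<^bsub>graph_Aut G\<^esub> \<delta> \<in> colour_Aut G R"
      using A by (simp add: colour_Aut_def graph_Aut_mult)
  qed
qed

text \<open>The tree hypothesis enters here: sending \<open>c\<close> to \<open>d\<close> extends to
  an immersion of the whole tree, whose restriction is an automorphism.\<close>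

lemma colour_Aut_transitive:
  assumes T: "undirected_tree G" and bal: "balanced G R" and cd: "(c, d) \<in> R"
  obtains \<gamma> where "\<gamma> \<in> colour_Aut G R" "\<gamma> c = d"
proof -
  interpret pair_graph G using T by (simp add: undirected_tree_def)
  have con: "Digraph_Component.connected (with_proj G)"
    and acyc: "\<And>p. cycle p \<Longrightarrow> length p < 3"
    using T unfolding undirected_tree_def by (auto simp: not_le[symmetric])
  obtain f where f: "colour_immersion G R (pverts G) f" "f c = d"
    using colour_immersion_exists[OF con acyc bal cd] .
  have "c \<in> pverts G" using bal cd equiv_type unfolding balanced_def by blast
  moreover have "restrict f (pverts G) \<in> colour_Aut G R"
    using colour_immersion_automorphism[OF con bal f(1)] f(1)
    by (auto simp: colour_Aut_def colour_immersion_def)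
  ultimately show thesis using that f(2) by simp
qed

section \<open>Polydiagonal and fixed-point space\<close>

theorem theorem3p1:
  fixes G :: "'a pair_pre_digraph"
    and R :: "'a rel"
  assumes "\<exists>B. finite_dimensional_vector_space ((*\<^sub>R) :: real \<Rightarrow> 'v \<Rightarrow> 'v::real_vector) B"
    and "\<exists>v::'v. v \<noteq> 0"
    and "undirected_tree G"
    and "balanced G R"
  shows "\<exists>\<Gamma>. subgroup \<Gamma> (graph_Aut G) \<and>
           (polydiagonal G R :: ('a \<Rightarrow> 'v) set) = Fix G \<Gamma>"
proof (intro exI conjI)
  have R: "equiv (pverts G) R" using assms(4) by (simp add: balanced_def)
  \<comment> \<open>This fixes the witness: all colour-preserving automorphisms, a group whose
    orbits are exactly the classes of \<open>R\<close>.\<close>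
  show sub: "subgroup (colour_Aut G R) (graph_Aut G)" by (rule subgroup_colour_Aut[OF R])
  show "(polydiagonal G R :: ('a \<Rightarrow> 'v) set) = Fix G (colour_Aut G R)"
  proof (intro equalityI subsetI)
    fix x :: "'a \<Rightarrow> 'v" assume x: "x \<in> polydiagonal G R"
    then have xP: "x \<in> phase_space G" by (simp add: polydiagonal_def)
    have "coord_action G \<gamma> x = x" if "\<gamma> \<in> colour_Aut G R" for \<gamma>
    proof
      fix c
      \<comment> \<open>The action reads coordinates through the inverse, which must therefore
        preserve colours too.\<close>
      have "inv\<^bsub>graph_Aut G\<^esub> \<gamma> \<in> colour_Aut G R"
        using subgroup.m_inv_closed[OF sub that] .
      then have "x ((inv\<^bsub>graph_Aut G\<^esub> \<gamma>) c) = x c" if "c \<in> pverts G"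
        using x that by (fastforce simp: polydiagonal_def colour_Aut_def)
      \<comment> \<open>Outside the vertex set both sides are \<open>undefined\<close>, since points
        of the phase space are extensional.\<close>
      then show "coord_action G \<gamma> x c = x c"
        using xP by (auto simp: coord_action_def phase_space_def PiE_def extensional_def)
    qed
    then show "x \<in> Fix G (colour_Aut G R)" using xP by (simp add: Fix_def)
  next
    fix x :: "'a \<Rightarrow> 'v" assume x: "x \<in> Fix G (colour_Aut G R)"
    then have xP: "x \<in> phase_space G" by (simp add: Fix_def)
    have "x c = x d" if cd: "(c, d) \<in> R" for c d
    proof -
      have V: "c \<in> pverts G" "d \<in> pverts G" using cd equiv_type[OF R] by auto
      obtain \<gamma> where g: "\<gamma> \<in> colour_Aut G R" "\<gamma> c = d"
        using colour_Aut_transitive[OF assms(3,4) cd] .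
      \<comment> \<open>Coordinate \<open>d\<close> is the one to inspect: the inverse of \<gamma>
        sends \<open>d\<close> to \<open>c\<close>, so the action puts \<open>x c\<close>
        there.\<close>
      then have "coord_action G \<gamma> x d = x d" using x by (simp add: Fix_def)
      then show ?thesis
        using graph_Aut_inv_cancel(2)[of \<gamma> G c] g V xP
        by (simp add: coord_action_def colour_Aut_def)
    qed
    then show "x \<in> polydiagonal G R" using xP by (simp add: polydiagonal_def)
  qed
qed

end
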